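(* Let $E:\mathbb{R}^n\to\mathbb{R}^n$ and $\Psi:\mathbb{R}^n\times\mathbb{R}^n\to\mathbb{R}^n$ be maps, and consider the problem (P): minimize $h(s)$ subject to $h_j(s)\le 0$, $1\le j\le k$, $s\in\mathbb{R}^n$, where $h,h_1,\dots,h_k:\mathbb{R}^n\to\mathbb{R}$ are either all SSEP w.r.t. $\Psi$ on $\mathbb{R}^n$ or all SQSEP w.r.t. $\Psi$ on $\mathbb{R}^n$. Let $X=\{s\in\mathbb{R}^n: h_j(s)\le 0,\ 1\le j\le k\}$ be the feasible set, let $X$ be an SEI set w.r.t. $\Psi$, and let $h$ be SSEP (respectively SQSEP) w.r.t. $\Psi$ on $X$. Let $\alpha\in[0,1]$. If $t^*\in X$ is a solution of the problem $(P_\alpha)$: minimize $h(\alpha t+Et)$ subject to $t\in X$, then $\alpha t^*+Et^*$ is a solution of (P).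
   Context: Write $Es$ for $E(s)$. A set $S\subseteq\mathbb{R}^n$ is strongly $E$-invex (SEI) w.r.t. $\Psi$ if $\alpha t+Et+\lambda\Psi(\alpha s+Es,\alpha t+Et)\in S$ for all $s,t\in S$, $\alpha\in[0,1]$, $\lambda\in[0,1]$. A function $h:\mathbb{R}^n\to\mathbb{R}$ is, on an SEI set $S$: - semi strongly $E$-preinvex (SSEP) w.r.t. $\Psi$ if $h(\alpha t+Et+\lambda\Psi(\alpha s+Es,\alpha t+Et))\le\lambda h(s)+(1-\lambda)h(t)$ for all $s,t\in S$, $\alpha,\lambda\in[0,1]$; - semi quasi strongly $E$-preinvex (SQSEP) w.r.t. $\Psi$ if $h(\alpha t+Et+\lambda\Psi(\alpha s+Es,\alpha t+Et))\le\max\{h(s),h(t)\}$ for all $s,t\in S$, $\alpha,\lambda\in[0,1]$. A solution of (P) is a point of $X$ at which $h$ attains its minimum over $X$; a solution of $(P_\alpha)$ is a point of $X$ minimizing $t\mapsto h(\alpha t+Et)$ over $X$. *)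

theory Defs
  imports "HOL-Analysis.Analysis"
begin

definition SEI ::
  "(real^'n \<Rightarrow> real^'n) \<Rightarrow> ((real^'n) \<times> (real^'n) \<Rightarrow> real^'n) \<Rightarrow> (real^'n) set \<Rightarrow> bool"
where
  "SEI E \<Psi> S \<longleftrightarrow>
     (\<forall>s\<in>S. \<forall>t\<in>S. \<forall>\<alpha>\<in>{0..1}. \<forall>\<mu>\<in>{0..1}.
        \<alpha> *\<^sub>R t + E t + \<mu> *\<^sub>R \<Psi> (\<alpha> *\<^sub>R s + E s, \<alpha> *\<^sub>R t + E t) \<in> S)"

text \<open>The two function classes below are only meaningful on strongly E-invex sets, so the
  invexity of the underlying set is part of both predicates.\<close>

definition SSEP_on ::
  "(real^'n \<Rightarrow> real^'n) \<Rightarrow> ((real^'n) \<times> (real^'n) \<Rightarrow> real^'n) \<Rightarrow> (real^'n) set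
     \<Rightarrow> (real^'n \<Rightarrow> real) \<Rightarrow> bool"
where
  "SSEP_on E \<Psi> S h \<longleftrightarrow> SEI E \<Psi> S \<and>
     (\<forall>s\<in>S. \<forall>t\<in>S. \<forall>\<alpha>\<in>{0..1}. \<forall>\<mu>\<in>{0..1}.
        h (\<alpha> *\<^sub>R t + E t + \<mu> *\<^sub>R \<Psi> (\<alpha> *\<^sub>R s + E s, \<alpha> *\<^sub>R t + E t))
          \<le> \<mu> * h s + (1 - \<mu>) * h t)"

definition SQSEP_on ::
  "(real^'n \<Rightarrow> real^'n) \<Rightarrow> ((real^'n) \<times> (real^'n) \<Rightarrow> real^'n) \<Rightarrow> (real^'n) set
     \<Rightarrow> (real^'n \<Rightarrow> real) \<Rightarrow> bool"
where
  "SQSEP_on E \<Psi> S h \<longleftrightarrow> SEI E \<Psi> S \<and>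
     (\<forall>s\<in>S. \<forall>t\<in>S. \<forall>\<alpha>\<in>{0..1}. \<forall>\<mu>\<in>{0..1}.
        h (\<alpha> *\<^sub>R t + E t + \<mu> *\<^sub>R \<Psi> (\<alpha> *\<^sub>R s + E s, \<alpha> *\<^sub>R t + E t))
          \<le> max (h s) (h t))"

definition feasible_set :: "nat \<Rightarrow> (nat \<Rightarrow> real^'n \<Rightarrow> real) \<Rightarrow> (real^'n) set" where
  "feasible_set k g = {s. \<forall>j\<in>{1..k}. g j s \<le> 0}"

definition minimizes_on :: "('a \<Rightarrow> real) \<Rightarrow> 'a set \<Rightarrow> 'a \<Rightarrow> bool" where
  "minimizes_on f X x \<longleftrightarrow> is_arg_min f (\<lambda>y. y \<in> X) x"

lemma minimizes_on_iff: "minimizes_on f X x \<longleftrightarrow> x \<in> X \<and> (\<forall>y\<in>X. f x \<le> f y)"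
  by (auto simp: minimizes_on_def is_arg_min_linorder)

end

theory Submission
  imports Defs
begin

text \<open>At \<open>\<mu> = 0\<close> and \<open>s = t\<close> the defining conditions say that \<open>t \<mapsto> \<alpha> t + E t\<close> maps
  \<open>X\<close> into itself and does not increase \<open>h\<close>, so the minimum of \<open>h\<close> over \<open>X\<close> is attained at an image point.\<close>

lemma SEI_translate_mem:
  assumes "SEI E \<Psi> S" "t \<in> S" "\<alpha> \<in> {0..1}"
  shows "\<alpha> *\<^sub>R t + E t \<in> S"
proof -
  \<comment> \<open>The vanishing \<open>\<Psi>\<close> term is kept so that the point matches the
    pattern in \<open>SEI_def\<close>.\<close>
  have "\<alpha> *\<^sub>R t + E t + 0 *\<^sub>R \<Psi> (\<alpha> *\<^sub>R t + E t, \<alpha> *\<^sub>R t + E t) \<in> S"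
    using assms unfolding SEI_def by (metis atLeastAtMost_iff order_refl zero_le_one)
  then show ?thesis by simp
qed

text \<open>A convex combination of two reals never exceeds the larger one. This merges both
  alternatives of the theorem into the quasi case.\<close>

lemma SSEP_on_imp_SQSEP_on:
  assumes "SSEP_on E \<Psi> S h"
  shows "SQSEP_on E \<Psi> S h"
proof -
  have "\<mu> * a + (1 - \<mu>) * b \<le> max a b" if "\<mu> \<in> {0..1}" for \<mu> a b :: real
    using that by (intro convex_bound_le) auto
  then show ?thesis
    using assms unfolding SSEP_on_def SQSEP_on_def by (meson order_trans)
qed

lemma SQSEP_on_translate_le:
  assumes "SQSEP_on E \<Psi> S h" "t \<in> S" "\<alpha> \<in> {0..1}"
  shows "h (\<alpha> *\<^sub>R t + E t) \<le> h t"
proof -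
  \<comment> \<open>Taking both points equal to \<open>t\<close> collapses the maximum to
    \<open>h t\<close>.\<close>
  have "h (\<alpha> *\<^sub>R t + E t + 0 *\<^sub>R \<Psi> (\<alpha> *\<^sub>R t + E t, \<alpha> *\<^sub>R t + E t)) \<le> max (h t) (h t)"
    using assms unfolding SQSEP_on_def by (metis atLeastAtMost_iff order_refl zero_le_one)
  then show ?thesis by simp
qed

theorem theorem21:
  fixes E :: "real^'n \<Rightarrow> real^'n"
    and \<Psi> :: "(real^'n) \<times> (real^'n) \<Rightarrow> real^'n"
    and h :: "real^'n \<Rightarrow> real"
    and g :: "nat \<Rightarrow> real^'n \<Rightarrow> real"
    and k :: nat
    and X :: "(real^'n) set"
    and \<alpha> :: real
    and t_star :: "real^'n"
  assumes X_eq: "X = feasible_set k g"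
    and X_SEI: "SEI E \<Psi> X"
    and preinvex:
      "(SSEP_on E \<Psi> UNIV h \<and> (\<forall>j\<in>{1..k}. SSEP_on E \<Psi> UNIV (g j)) \<and> SSEP_on E \<Psi> X h) \<or>
       (SQSEP_on E \<Psi> UNIV h \<and> (\<forall>j\<in>{1..k}. SQSEP_on E \<Psi> UNIV (g j)) \<and> SQSEP_on E \<Psi> X h)"
    and alpha: "\<alpha> \<in> {0..1}"
    and sol: "minimizes_on (\<lambda>t. h (\<alpha> *\<^sub>R t + E t)) X t_star"
  shows "minimizes_on h X (\<alpha> *\<^sub>R t_star + E t_star)"
proof -
  have "SQSEP_on E \<Psi> X h"
    using preinvex SSEP_on_imp_SQSEP_on by blast
  \<comment> \<open>Invexity gives feasibility. For \<open>y\<close> in \<open>X\<close>, minimality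
    of \<open>t_star\<close> and then the translate bound at \<open>y\<close> yield \<open>h
    (\<alpha> *\<^sub>R t_star + E t_star) \<le> h (\<alpha> *\<^sub>R y + E y) \<le> h
    y\<close>.\<close>
  then show ?thesis
    using sol SEI_translate_mem[OF X_SEI _ alpha] SQSEP_on_translate_le[OF _ _ alpha]
    unfolding minimizes_on_iff by (meson order_trans)
qed

end
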